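(* Let $(G,\mu,\omega)$ be an infinite, connected weighted graph, and let $d$ be an intrinsic pseudo metric on it, with finite jump size $s$, such that every ball $B_r(x)$ ($x\in G$, $r>0$) is a finite set. Let $x_0\in G$, $c_0>0$, $k>s$ and $0<\alpha\le 2$, and let $V:G\to[0,\infty)$ satisfy $$V(x)\ \ge\ c_0\,[d(x,x_0)+k]^{-\alpha}\qquad\text{for all } x\in G.$$ Let $u:G\to\mathbb{R}$ be a solution of $\Delta u-Vu=0$ in $G$. Suppose that $u\in \ell^p_{\zeta_\beta}(G,\mu)$, where $\zeta_\beta(x)=[d(x,x_0)+k]^{-\beta}$, for some $\beta>0$ and $p\ge 2$ fulfilling $$p\ \ge\ \frac{\beta^2}{2c_0}\left(\frac{k^{\beta+1}}{(k-s)^{\beta+1}}\right)^2 .$$ Then $u(x)=0$ for all $x\in G$.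
   Context: A weighted graph $(G,\mu,\omega)$ consists of a set $G$ of vertices, a node measure $\mu:G\to(0,\infty)$, and an edge weight $\omega:G\times G\to[0,\infty)$ such that $\omega(x,x)=0$ for all $x$, $\omega(x,y)=\omega(y,x)$ for all $x,y$, and $\sum_{y\in G}\omega(x,y)<\infty$ for all $x$. It is called infinite if $G$ is infinite and countable. Write $x\sim y$ if $\omega(x,y)>0$. The graph is connected if any two vertices are joined by a path, i.e. a finite sequence of vertices in which consecutive ones satisfy $\sim$. A pseudo metric is a map $d:G\times G\to[0,\infty)$ with $d(x,x)=0$, $d(x,y)=d(y,x)$ and $d(x,y)\le d(x,z)+d(y,z)$ for all $x,y,z\in G$ (possibly $d(x,y)=0$ with $x\ne y$). Its jump size is $s=\sup\{d(x,y): x,y\in G,\ \omega(x,y)>0\}$. Balls are $B_r(x_0)=\{x\in G: d(x,x_0)<r\}$. The pseudo metric $d$ is intrinsic if $\frac1{\mu(x)}\sum_{y\in G}\omega(x,y)\,d(x,y)^2\le 1$ for all $x\in G$. The weighted graph Laplacian is $\Delta f(x)=\frac1{\mu(x)}\sum_{y\sim x}\omega(x,y)[f(y)-f(x)]$ for $f:G\to\mathbb{R}$, $x\in G$. (Finite jump size and finiteness of balls imply that each vertex has finitely many neighbours.) A solution of $\Delta u-Vu=0$ in $G$ is a function $u:G\to\mathbb{R}$ with $\Delta u(x)-V(x)u(x)=0$ for every $x\in G$. For $\zeta:G\to(0,\infty)$ and $p\in[1,\infty)$, $\ell^p_\zeta(G,\mu)=\{u:G\to\mathbb{R}:\ \sum_{x\in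 G}|u(x)|^p\zeta(x)\mu(x)<\infty\}$. *)

theory Defs
  imports "HOL-Analysis.Analysis"
begin

text \<open>
  A vertex set is an explicit carrier \<open>G :: 'a set\<close>; functions on \<open>G\<close> or \<open>G \<times> G\<close> are total
  HOL functions of which only the values at points of \<open>G\<close> matter.
\<close>

locale weighted_graph =
  fixes G :: "'a set" and \<mu> :: "'a \<Rightarrow> real" and \<omega> :: "'a \<Rightarrow> 'a \<Rightarrow> real"
  assumes measure_pos: "x \<in> G \<Longrightarrow> \<mu> x > 0"
    and weight_nonneg: "x \<in> G \<Longrightarrow> y \<in> G \<Longrightarrow> \<omega> x y \<ge> 0"
    and weight_refl: "x \<in> G \<Longrightarrow> \<omega> x x = 0"
    and weight_sym: "x \<in> G \<Longrightarrow> y \<in> G \<Longrightarrow> \<omega> x y = \<omega> y x"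
    and weight_summable: "x \<in> G \<Longrightarrow> (\<lambda>y. \<omega> x y) summable_on G"

definition infinite_graph :: "'a set \<Rightarrow> bool" where
  "infinite_graph G \<longleftrightarrow> infinite G \<and> countable G"

definition adjacent :: "('a \<Rightarrow> 'a \<Rightarrow> real) \<Rightarrow> 'a \<Rightarrow> 'a \<Rightarrow> bool" where
  "adjacent \<omega> x y \<longleftrightarrow> \<omega> x y > 0"

definition graph_path :: "'a set \<Rightarrow> ('a \<Rightarrow> 'a \<Rightarrow> real) \<Rightarrow> 'a \<Rightarrow> 'a list \<Rightarrow> 'a \<Rightarrow> bool" where
  "graph_path G \<omega> x xs y \<longleftrightarrow>
     xs \<noteq> [] \<and> set xs \<subseteq> G \<and> hd xs = x \<and> last xs = y \<and> successively (adjacent \<omega>) xs"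

definition connected_graph :: "'a set \<Rightarrow> ('a \<Rightarrow> 'a \<Rightarrow> real) \<Rightarrow> bool" where
  "connected_graph G \<omega> \<longleftrightarrow> (\<forall>x\<in>G. \<forall>y\<in>G. \<exists>xs. graph_path G \<omega> x xs y)"

definition pseudo_metric :: "'a set \<Rightarrow> ('a \<Rightarrow> 'a \<Rightarrow> real) \<Rightarrow> bool" where
  "pseudo_metric G d \<longleftrightarrow>
     (\<forall>x\<in>G. \<forall>y\<in>G. d x y \<ge> 0) \<and>
     (\<forall>x\<in>G. d x x = 0) \<and>
     (\<forall>x\<in>G. \<forall>y\<in>G. d x y = d y x) \<and>
     (\<forall>x\<in>G. \<forall>y\<in>G. \<forall>z\<in>G. d x y \<le> d x z + d y z)"

text \<open>
  The jump size is an extended real, so that \<open>jump_size G \<omega> d = ereal s\<close> says both that it is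
  finite and that its value is \<open>s\<close>.
\<close>

definition jump_size :: "'a set \<Rightarrow> ('a \<Rightarrow> 'a \<Rightarrow> real) \<Rightarrow> ('a \<Rightarrow> 'a \<Rightarrow> real) \<Rightarrow> ereal" where
  "jump_size G \<omega> d = Sup {ereal (d x y) | x y. x \<in> G \<and> y \<in> G \<and> adjacent \<omega> x y}"

definition graph_ball :: "'a set \<Rightarrow> ('a \<Rightarrow> 'a \<Rightarrow> real) \<Rightarrow> 'a \<Rightarrow> real \<Rightarrow> 'a set" where
  "graph_ball G d x\<^sub>0 r = {x \<in> G. d x x\<^sub>0 < r}"

text \<open>
  Summability is required explicitly because \<open>infsum\<close> is \<open>0\<close> on divergent sums.
\<close>

definition intrinsic ::
    "'a set \<Rightarrow> ('a \<Rightarrow> real) \<Rightarrow> ('a \<Rightarrow> 'a \<Rightarrow> real) \<Rightarrow> ('a \<Rightarrow> 'a \<Rightarrow> real) \<Rightarrow> bool" where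
  "intrinsic G \<mu> \<omega> d \<longleftrightarrow>
     (\<forall>x\<in>G. (\<lambda>y. \<omega> x y * (d x y)\<^sup>2) summable_on G \<and>
            1 / \<mu> x * (\<Sum>\<^sub>\<infinity>y\<in>G. \<omega> x y * (d x y)\<^sup>2) \<le> 1)"

text \<open>
  On a locally finite graph the sum below is a finite one. Finite jump size together with
  finiteness of balls implies local finiteness.
\<close>

definition laplacian ::
    "'a set \<Rightarrow> ('a \<Rightarrow> real) \<Rightarrow> ('a \<Rightarrow> 'a \<Rightarrow> real) \<Rightarrow> ('a \<Rightarrow> real) \<Rightarrow> 'a \<Rightarrow> real" where
  "laplacian G \<mu> \<omega> f x =
     1 / \<mu> x * (\<Sum>\<^sub>\<infinity>y\<in>{y \<in> G. adjacent \<omega> x y}. \<omega> x y * (f y - f x))"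

definition schroedinger_solution ::
    "'a set \<Rightarrow> ('a \<Rightarrow> real) \<Rightarrow> ('a \<Rightarrow> 'a \<Rightarrow> real) \<Rightarrow> ('a \<Rightarrow> real) \<Rightarrow> ('a \<Rightarrow> real) \<Rightarrow> bool" where
  "schroedinger_solution G \<mu> \<omega> V u \<longleftrightarrow> (\<forall>x\<in>G. laplacian G \<mu> \<omega> u x - V x * u x = 0)"

definition weighted_ell ::
    "'a set \<Rightarrow> ('a \<Rightarrow> real) \<Rightarrow> ('a \<Rightarrow> real) \<Rightarrow> real \<Rightarrow> ('a \<Rightarrow> real) set" where
  "weighted_ell G \<mu> \<zeta> p = {u. (\<lambda>x. \<bar>u x\<bar> powr p * \<zeta> x * \<mu> x) summable_on G}"

end

theory Submission
  imports Defs
begin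

text \<open>
  Kato's inequality for the convex function \<open>t \<mapsto> \<bar>t\<bar> powr (p / 2)\<close> makes \<open>v = \<bar>u\<bar> powr (p / 2)\<close>
  a subsolution, \<open>\<Delta> v \<ge> (p / 2) V v\<close>, with \<open>v\<close> in the weighted \<open>\<ell>\<^sup>2\<close>. Testing this
  with \<open>v \<phi>\<^sup>2\<close> gives
  \<open>(p / 2) \<Sum> V v\<^sup>2 \<phi>\<^sup>2 \<mu> \<le> 1 / 2 \<Sum>\<^sub>x v(x)\<^sup>2 \<Sum>\<^sub>y \<omega>(x,y) (\<phi>(x) - \<phi>(y))\<^sup>2\<close>.
  Write \<open>r = d(\<cdot>,x\<^sub>0) + K\<close> and take \<open>\<phi> = max (r powr (- \<beta> / 2) - \<delta>) 0\<close>: it has finite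
  support because balls are finite, and its increments are at most those of \<open>r powr (- \<beta> / 2)\<close>, so
  the truncation costs no error term. As \<open>\<delta>\<close> tends to 0, both sides become multiples of
  the convergent sum \<open>\<Sum> v\<^sup>2 r powr (- \<beta> - 2) \<mu>\<close>, and the bound on \<open>p\<close> forces this sum to vanish.
\<close>

section \<open>Inequalities for real powers and a discrete Caccioppoli estimate\<close>

lemma powr_above_tangent:
  fixes a b q :: real
  assumes "q \<ge> 1" "a > 0" "b \<ge> 0"
  shows "q * a powr (q - 1) * (b - a) \<le> b powr q - a powr q"
\<comment> \<open>The convexity criterion is applied on the open half-line, where the power is twice
  differentiable. The boundary point \<open>b = 0\<close> is treated by hand; there the claim is
  \<open>a powr q \<le> q * a powr q\<close>.\<close>
proof (cases "b = 0")
  case True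
  have "a powr q = a powr (q - 1) * a"
    using assms(2) by (simp add: powr_diff)
  then have "q * a powr (q - 1) * (b - a) = - (q * a powr q)"
    by (simp add: True)
  moreover have "1 * a powr q \<le> q * a powr q"
    using assms(1) by (intro mult_right_mono) auto
  ultimately show ?thesis
    using True assms(1) by (simp add: mult.assoc)
next
  case False
  show ?thesis
  proof (rule f''_imp_f'[where C = "{0<..}" and f'' = "\<lambda>x. q * ((q - 1) * x powr (q - 1 - 1))"])
    fix x :: real assume "x \<in> {0<..}"
    then show "((\<lambda>x. x powr q) has_real_derivative q * x powr (q - 1)) (at x)"
      and "((\<lambda>x. q * x powr (q - 1)) has_real_derivative q * ((q - 1) * x powr (q - 1 - 1))) (at x)"
      and "0 \<le> q * ((q - 1) * x powr (q - 1 - 1))"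
      using assms(1) by (auto intro!: derivative_eq_intros)
  qed (use assms False in auto)
qed

text \<open>The slope \<open>q * \<bar>a\<bar> powr (q - 1)\<close> is nonnegative, so
  \<open>sgn a * (b - a) \<le> \<bar>b\<bar> - \<bar>a\<bar>\<close> reduces the claim to the
  tangent inequality on the half-line.\<close>

lemma abs_powr_above_tangent:
  fixes a b q :: real
  assumes "q \<ge> 1" "a \<noteq> 0"
  shows "q * \<bar>a\<bar> powr (q - 1) * sgn a * (b - a) \<le> \<bar>b\<bar> powr q - \<bar>a\<bar> powr q"
proof -
  have "sgn a * (b - a) \<le> \<bar>b\<bar> - \<bar>a\<bar>"
    by (auto simp: sgn_if)
  then have "q * \<bar>a\<bar> powr (q - 1) * (sgn a * (b - a)) \<le> q * \<bar>a\<bar> powr (q - 1) * (\<bar>b\<bar> - \<bar>a\<bar>)"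
    using assms(1) by (intro mult_left_mono) auto
  also have "\<dots> \<le> \<bar>b\<bar> powr q - \<bar>a\<bar> powr q"
    using assms by (intro powr_above_tangent) auto
  finally show ?thesis
    by (simp add: mult.assoc)
qed

text \<open>Mean value bound: the derivative has modulus
  \<open>\<gamma> * x powr (- \<gamma> - 1)\<close>, which does not increase in \<open>x\<close> and
  is therefore largest at the left end \<open>m\<close>.\<close>

lemma powr_minus_lipschitz:
  fixes a b m \<gamma> :: real
  assumes "\<gamma> \<ge> 0" "m > 0" "m \<le> a" "m \<le> b"
  shows "\<bar>a powr (- \<gamma>) - b powr (- \<gamma>)\<bar> \<le> \<gamma> * m powr (- \<gamma> - 1) * \<bar>a - b\<bar>"
proof -
  have "norm (a powr (- \<gamma>) - b powr (- \<gamma>)) \<le> \<gamma> * m powr (- \<gamma> - 1) * norm (a - b)"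
  proof (rule field_differentiable_bound[where S = "{m..}" and f' = "\<lambda>x. - \<gamma> * x powr (- \<gamma> - 1)"])
    fix x assume x: "x \<in> {m..}"
    show "((\<lambda>x. x powr (- \<gamma>)) has_field_derivative - \<gamma> * x powr (- \<gamma> - 1)) (at x within {m..})"
      using assms x by (auto intro!: derivative_eq_intros)
    have "x powr (- \<gamma> - 1) \<le> m powr (- \<gamma> - 1)"
      using assms x by (intro powr_mono2') auto
    then show "norm (- \<gamma> * x powr (- \<gamma> - 1)) \<le> \<gamma> * m powr (- \<gamma> - 1)"
      using assms(1) by (simp add: abs_mult mult_left_mono)
  qed (use assms in auto)
  then show ?thesis by simp
qed

text \<open>Summation by parts: both sums run over the same \<open>A\<close> and \<open>w\<close> is
  symmetric, so each double sum may be averaged with its transpose and no boundary term appears.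
  What remains is a pointwise inequality for each pair.\<close>

lemma discrete_caccioppoli:
  fixes w :: "'a \<Rightarrow> 'a \<Rightarrow> real" and v \<phi> :: "'a \<Rightarrow> real"
  assumes sym: "\<And>x y. x \<in> A \<Longrightarrow> y \<in> A \<Longrightarrow> w x y = w y x"
    and nonneg: "\<And>x y. x \<in> A \<Longrightarrow> y \<in> A \<Longrightarrow> w x y \<ge> 0"
  shows "(\<Sum>x\<in>A. (\<phi> x)\<^sup>2 * v x * (\<Sum>y\<in>A. w x y * (v y - v x)))
         \<le> 1 / 2 * (\<Sum>x\<in>A. (v x)\<^sup>2 * (\<Sum>y\<in>A. w x y * (\<phi> x - \<phi> y)\<^sup>2))"
    (is "?S \<le> 1 / 2 * ?R")
proof -
  have S: "?S = (\<Sum>x\<in>A. \<Sum>y\<in>A. w x y * ((\<phi> x)\<^sup>2 * v x * (v y - v x)))"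
    by (simp add: sum_distrib_left mult_ac)
  have S': "?S = (\<Sum>x\<in>A. \<Sum>y\<in>A. w x y * ((\<phi> y)\<^sup>2 * v y * (v x - v y)))"
    unfolding S by (subst sum.swap) (auto intro!: sum.cong simp: sym)
  have R: "?R = (\<Sum>x\<in>A. \<Sum>y\<in>A. w x y * ((v x)\<^sup>2 * (\<phi> x - \<phi> y)\<^sup>2))"
    by (simp add: sum_distrib_left mult_ac)
  have R': "?R = (\<Sum>x\<in>A. \<Sum>y\<in>A. w x y * ((v y)\<^sup>2 * (\<phi> x - \<phi> y)\<^sup>2))"
    unfolding R by (subst sum.swap) (auto intro!: sum.cong simp: sym power2_commute)
  have "2 * ?S = (\<Sum>x\<in>A. \<Sum>y\<in>A. w x y *
      ((\<phi> x)\<^sup>2 * v x * (v y - v x) + (\<phi> y)\<^sup>2 * v y * (v x - v y)))"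
    using S S' by (simp add: sum.distrib distrib_left)
  also have "\<dots> \<le> (\<Sum>x\<in>A. \<Sum>y\<in>A. w x y *
      (1 / 2 * ((v x)\<^sup>2 * (\<phi> x - \<phi> y)\<^sup>2 + (v y)\<^sup>2 * (\<phi> x - \<phi> y)\<^sup>2)))"
  proof (intro sum_mono mult_left_mono nonneg)
    fix x y
    \<comment> \<open>The gap is a sum of squares; the first one is the energy of the product of
      \<open>\<phi>\<close> and \<open>v\<close>, which is discarded.\<close>
    have "1 / 2 * ((v x)\<^sup>2 * (\<phi> x - \<phi> y)\<^sup>2 + (v y)\<^sup>2 * (\<phi> x - \<phi> y)\<^sup>2)
        - ((\<phi> x)\<^sup>2 * v x * (v y - v x) + (\<phi> y)\<^sup>2 * v y * (v x - v y))
        = (\<phi> x * v x - \<phi> y * v y)\<^sup>2 + 1 / 2 * ((v x - v y) * (\<phi> x - \<phi> y))\<^sup>2"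
      by (simp add: power2_eq_square field_simps)
    also have "\<dots> \<ge> 0" by simp
    finally show "(\<phi> x)\<^sup>2 * v x * (v y - v x) + (\<phi> y)\<^sup>2 * v y * (v x - v y)
        \<le> 1 / 2 * ((v x)\<^sup>2 * (\<phi> x - \<phi> y)\<^sup>2 + (v y)\<^sup>2 * (\<phi> x - \<phi> y)\<^sup>2)"
      by linarith
  qed
  also have "\<dots> = 1 / 2 * (?R + ?R)"
    by (subst (2) R', subst R)
       (simp add: sum.distrib distrib_left sum_distrib_left sum_divide_distrib mult_ac add_divide_distrib)
  finally show ?thesis by simp
qed

text \<open>The quotient \<open>r / (r - s)\<close> does not increase in \<open>r\<close>, so it is
  largest at \<open>r = k\<close>. This trades \<open>r - s\<close> for \<open>r\<close> at the
  price of a constant.\<close>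

lemma powr_shift_bound:
  fixes r s k \<gamma> :: real
  assumes "0 \<le> s" "s < k" "k \<le> r" "\<gamma> \<ge> 0"
  shows "(r - s) powr (- \<gamma>) \<le> (k / (k - s)) powr \<gamma> * r powr (- \<gamma>)"
proof -
  have "k * s \<le> r * s" using assms by (intro mult_right_mono) auto
  then have "r / (r - s) \<le> k / (k - s)"
    using assms by (simp add: field_simps)
  then have "(r / (r - s)) powr \<gamma> \<le> (k / (k - s)) powr \<gamma>"
    using assms by (intro powr_mono2) auto
  then have "(r / (r - s)) powr \<gamma> * r powr (- \<gamma>) \<le> (k / (k - s)) powr \<gamma> * r powr (- \<gamma>)"
    by (rule mult_right_mono) simp
  moreover have "(r / (r - s)) powr \<gamma> * r powr (- \<gamma>) = (r - s) powr (- \<gamma>)"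
    using assms by (simp add: powr_divide powr_minus field_simps)
  ultimately show ?thesis by simp
qed

section \<open>Kato's inequality and the energy estimate on the graph\<close>

context weighted_graph
begin

text \<open>A real jump size forces an edge to exist, since in \<open>ereal\<close> the supremum of
  the empty set is minus infinity. The length of that edge is a nonnegative lower bound for
  \<open>s\<close>.\<close>

lemma jump_size_nonneg:
  assumes "pseudo_metric G d" "jump_size G \<omega> d = ereal s"
  shows "s \<ge> 0"
proof -
  have "\<exists>x\<in>G. \<exists>y\<in>G. adjacent \<omega> x y"
  proof (rule ccontr)
    assume "\<not> ?thesis"
    then have "{ereal (d x y) | x y. x \<in> G \<and> y \<in> G \<and> adjacent \<omega> x y} = {}" by auto
    then have "jump_size G \<omega> d = -\<infinity>"
      unfolding jump_size_def by (simp only: Sup_empty bot_ereal_def)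
    with assms(2) show False by simp
  qed
  then obtain x y where xy: "x \<in> G" "y \<in> G" "adjacent \<omega> x y" by blast
  then have "ereal (d x y) \<le> ereal s"
    unfolding assms(2)[symmetric] jump_size_def by (intro Sup_upper) auto
  moreover have "d x y \<ge> 0" using assms(1) xy by (auto simp: pseudo_metric_def)
  ultimately show ?thesis by simp
qed

lemma dist_le_jump_size:
  assumes "jump_size G \<omega> d = ereal s" "x \<in> G" "y \<in> G" "adjacent \<omega> x y"
  shows "d x y \<le> s"
proof -
  have "ereal (d x y) \<le> ereal s"
    unfolding assms(1)[symmetric] jump_size_def using assms by (intro Sup_upper) auto
  then show ?thesis by simp
qed

text \<open>Vertices of \<open>A\<close> that are not neighbours of \<open>x\<close> have weight 0.
  One set \<open>A\<close> can thus serve for many vertices at once, as the symmetrisation in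
  \<open>discrete_caccioppoli\<close> requires.\<close>

lemma laplacian_eq_sum:
  assumes "x \<in> G" "finite A" "A \<subseteq> G" "{y \<in> G. adjacent \<omega> x y} \<subseteq> A"
  shows "\<mu> x * laplacian G \<mu> \<omega> f x = (\<Sum>y\<in>A. \<omega> x y * (f y - f x))"
proof -
  have "\<mu> x * laplacian G \<mu> \<omega> f x = (\<Sum>\<^sub>\<infinity>y\<in>{y \<in> G. adjacent \<omega> x y}. \<omega> x y * (f y - f x))"
    using measure_pos[OF assms(1)] by (simp add: laplacian_def)
  also have "\<dots> = (\<Sum>y\<in>{y \<in> G. adjacent \<omega> x y}. \<omega> x y * (f y - f x))"
    using assms finite_subset by (intro infsum_finite) blast
  also have "\<dots> = (\<Sum>y\<in>A. \<omega> x y * (f y - f x))"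
    using assms weight_nonneg[OF assms(1)]
    by (intro sum.mono_neutral_left) (auto simp: adjacent_def, force)
  finally show ?thesis .
qed

text \<open>Kato's inequality for the convex function \<open>t \<mapsto> \<bar>t\<bar>\<^sup>q\<close>, multiplied by \<open>\<bar>u\<bar>\<^sup>q\<close> so that no
  derivative at the zeros of \<open>u\<close> is involved.\<close>

lemma kato_powr:
  assumes "q \<ge> 1" "x \<in> G" "finite A" "A \<subseteq> G" "{y \<in> G. adjacent \<omega> x y} \<subseteq> A"
    and sol: "laplacian G \<mu> \<omega> u x = V x * u x"
  shows "q * V x * (\<bar>u x\<bar> powr q)\<^sup>2 * \<mu> x
         \<le> \<bar>u x\<bar> powr q * (\<Sum>y\<in>A. \<omega> x y * (\<bar>u y\<bar> powr q - \<bar>u x\<bar> powr q))"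
\<comment> \<open>At a zero of \<open>u\<close> both sides vanish because
  \<open>0 powr q = 0\<close>.\<close>
proof (cases "u x = 0")
  case False
  \<comment> \<open>\<open>c\<close> is the slope of the convex function at \<open>u x\<close>;
    Euler's relation for this homogeneous function,
    \<open>c * u x = q * \<bar>u x\<bar> powr q\<close>, produces the factor \<open>q\<close> in
    front of \<open>V\<close>.\<close>
  define c where "c = q * \<bar>u x\<bar> powr (q - 1) * sgn (u x)"
  have "sgn (u x) * u x = \<bar>u x\<bar>" by (simp add: sgn_if)
  moreover have "\<bar>u x\<bar> powr q = \<bar>u x\<bar> powr (q - 1) * \<bar>u x\<bar>"
    using False by (simp add: powr_diff)
  ultimately have c: "c * u x = q * \<bar>u x\<bar> powr q"
    by (simp add: c_def mult.assoc)
  have "q * V x * \<bar>u x\<bar> powr q * \<mu> x = V x * (c * u x) * \<mu> x"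
    by (simp add: c)
  also have "\<dots> = c * (\<mu> x * laplacian G \<mu> \<omega> u x)"
    by (simp add: sol)
  also have "\<dots> = (\<Sum>y\<in>A. \<omega> x y * (c * (u y - u x)))"
    using assms by (subst laplacian_eq_sum[of _ A]) (auto simp: sum_distrib_left mult_ac)
  also have "\<dots> \<le> (\<Sum>y\<in>A. \<omega> x y * (\<bar>u y\<bar> powr q - \<bar>u x\<bar> powr q))"
    unfolding c_def using assms False
    by (intro sum_mono mult_left_mono weight_nonneg abs_powr_above_tangent) auto
  finally have "\<bar>u x\<bar> powr q * (q * V x * \<bar>u x\<bar> powr q * \<mu> x)
      \<le> \<bar>u x\<bar> powr q * (\<Sum>y\<in>A. \<omega> x y * (\<bar>u y\<bar> powr q - \<bar>u x\<bar> powr q))"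
    by (rule mult_left_mono) simp
  then show ?thesis by (simp add: power2_eq_square mult_ac)
qed simp

lemma intrinsic_finite_sum:
  assumes "intrinsic G \<mu> \<omega> d" "x \<in> G" "finite A" "A \<subseteq> G"
  shows "(\<Sum>y\<in>A. \<omega> x y * (d x y)\<^sup>2) \<le> \<mu> x"
proof -
  have "(\<Sum>y\<in>A. \<omega> x y * (d x y)\<^sup>2) \<le> (\<Sum>\<^sub>\<infinity>y\<in>G. \<omega> x y * (d x y)\<^sup>2)"
    using assms by (intro finite_sum_le_infsum) (auto simp: intrinsic_def weight_nonneg)
  also have "\<dots> \<le> \<mu> x"
    using assms measure_pos[of x] by (auto simp: intrinsic_def field_simps)
  finally show ?thesis .
qed

text \<open>The test-function argument for a general weight \<open>\<psi>\<close> whose truncations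
  have finite support. The Lipschitz factor \<open>L x\<close> depends on one endpoint only, so it
  leaves the inner sum and the intrinsic condition bounds the rest by
  \<open>\<mu> x\<close>.\<close>

lemma weighted_energy_bound:
  fixes d :: "'a \<Rightarrow> 'a \<Rightarrow> real" and \<psi> L u V :: "'a \<Rightarrow> real"
  assumes intr: "intrinsic G \<mu> \<omega> d"
    and loc_fin: "\<And>x. x \<in> G \<Longrightarrow> finite {y \<in> G. adjacent \<omega> x y}"
    and superlevel: "\<And>\<delta>. \<delta> > 0 \<Longrightarrow> finite {x \<in> G. \<psi> x > \<delta>}"
    and \<psi>_pos: "\<And>x. x \<in> G \<Longrightarrow> \<psi> x \<ge> 0"
    and lip: "\<And>x y. x \<in> G \<Longrightarrow> y \<in> G \<Longrightarrow> adjacent \<omega> x y \<Longrightarrow> \<bar>\<psi> x - \<psi> y\<bar> \<le> L x * d x y"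
    and sol: "schroedinger_solution G \<mu> \<omega> V u"
    and V: "\<And>x. x \<in> G \<Longrightarrow> V x \<ge> 0"
    and q: "q \<ge> 1"
    and bound: "\<And>A. finite A \<Longrightarrow> A \<subseteq> G \<Longrightarrow> (\<Sum>x\<in>A. (L x)\<^sup>2 * (\<bar>u x\<bar> powr q)\<^sup>2 * \<mu> x) \<le> I"
    and F: "finite F" "F \<subseteq> G"
  shows "(\<Sum>x\<in>F. q * V x * (\<psi> x)\<^sup>2 * (\<bar>u x\<bar> powr q)\<^sup>2 * \<mu> x) \<le> 1 / 2 * I"
proof -
  define v where "v x = \<bar>u x\<bar> powr q" for x
  define \<phi> where "\<phi> \<delta> x = max (\<psi> x - \<delta>) 0" for \<delta> x
  have trunc: "(\<Sum>x\<in>F. q * V x * (\<phi> \<delta> x)\<^sup>2 * (v x)\<^sup>2 * \<mu> x) \<le> 1 / 2 * I" if "\<delta> > 0" for \<delta>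
  proof -
    define B where "B = {x \<in> G. \<psi> x > \<delta>}"
    \<comment> \<open>\<open>A\<close> contains every neighbour of \<open>B\<close>, so Kato's
      inequality is available on \<open>B\<close>. Other vertices of \<open>A\<close> may lack
      neighbours in \<open>A\<close>, but the test function vanishes there.\<close>
    define A where "A = F \<union> B \<union> (\<Union>x\<in>B. {y \<in> G. adjacent \<omega> x y})"
    have A: "finite A" "A \<subseteq> G" "F \<subseteq> A"
      using F superlevel[OF that] loc_fin by (auto simp: A_def B_def)
    have "(\<Sum>x\<in>F. q * V x * (\<phi> \<delta> x)\<^sup>2 * (v x)\<^sup>2 * \<mu> x) \<le> (\<Sum>x\<in>A. q * V x * (\<phi> \<delta> x)\<^sup>2 * (v x)\<^sup>2 * \<mu> x)"
      using A q V measure_pos by (intro sum_mono2) (auto intro!: mult_nonneg_nonneg simp: less_imp_le subset_iff)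
    also have "\<dots> \<le> (\<Sum>x\<in>A. (\<phi> \<delta> x)\<^sup>2 * v x * (\<Sum>y\<in>A. \<omega> x y * (v y - v x)))"
    proof (rule sum_mono)
      fix x assume "x \<in> A"
      show "q * V x * (\<phi> \<delta> x)\<^sup>2 * (v x)\<^sup>2 * \<mu> x \<le> (\<phi> \<delta> x)\<^sup>2 * v x * (\<Sum>y\<in>A. \<omega> x y * (v y - v x))"
      proof (cases "x \<in> B")
        case True
        have "q * V x * (v x)\<^sup>2 * \<mu> x \<le> v x * (\<Sum>y\<in>A. \<omega> x y * (v y - v x))"
          unfolding v_def
        proof (rule kato_powr)
          show "laplacian G \<mu> \<omega> u x = V x * u x"
            using sol True by (simp add: schroedinger_solution_def B_def)
          show "{y \<in> G. adjacent \<omega> x y} \<subseteq> A"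
            using True by (auto simp: A_def)
        qed (use q A True in \<open>auto simp: B_def\<close>)
        then have "(\<phi> \<delta> x)\<^sup>2 * (q * V x * (v x)\<^sup>2 * \<mu> x) \<le> (\<phi> \<delta> x)\<^sup>2 * (v x * (\<Sum>y\<in>A. \<omega> x y * (v y - v x)))"
          by (rule mult_left_mono) simp
        then show ?thesis by (simp add: mult_ac)
      next
        case False
        then have "\<phi> \<delta> x = 0" using \<open>x \<in> A\<close> A by (auto simp: B_def \<phi>_def)
        then show ?thesis by simp
      qed
    qed
    also have "\<dots> \<le> 1 / 2 * (\<Sum>x\<in>A. (v x)\<^sup>2 * (\<Sum>y\<in>A. \<omega> x y * (\<phi> \<delta> x - \<phi> \<delta> y)\<^sup>2))"
      using A by (intro discrete_caccioppoli weight_sym weight_nonneg) auto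
    also have "\<dots> \<le> 1 / 2 * (\<Sum>x\<in>A. (v x)\<^sup>2 * ((L x)\<^sup>2 * \<mu> x))"
    proof (intro mult_left_mono sum_mono)
      fix x assume x: "x \<in> A"
      have "(\<Sum>y\<in>A. \<omega> x y * (\<phi> \<delta> x - \<phi> \<delta> y)\<^sup>2) \<le> (\<Sum>y\<in>A. (L x)\<^sup>2 * (\<omega> x y * (d x y)\<^sup>2))"
      proof (rule sum_mono)
        fix y assume y: "y \<in> A"
        have xy: "x \<in> G" "y \<in> G" using x y A by auto
        show "\<omega> x y * (\<phi> \<delta> x - \<phi> \<delta> y)\<^sup>2 \<le> (L x)\<^sup>2 * (\<omega> x y * (d x y)\<^sup>2)"
        proof (cases "adjacent \<omega> x y")
          case True
          have "\<bar>\<phi> \<delta> x - \<phi> \<delta> y\<bar> \<le> \<bar>\<psi> x - \<psi> y\<bar>"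
            by (auto simp: \<phi>_def)
          also have "\<dots> \<le> \<bar>L x * d x y\<bar>"
            using lip[OF xy True] by linarith
          finally have "(\<phi> \<delta> x - \<phi> \<delta> y)\<^sup>2 \<le> (L x * d x y)\<^sup>2"
            by (simp only: abs_le_square_iff)
          then have "\<omega> x y * (\<phi> \<delta> x - \<phi> \<delta> y)\<^sup>2 \<le> \<omega> x y * (L x * d x y)\<^sup>2"
            using xy weight_nonneg by (intro mult_left_mono) auto
          then show ?thesis by (simp add: power_mult_distrib mult_ac)
        next
          case False
          then have "\<omega> x y = 0" using weight_nonneg[OF xy] by (simp add: adjacent_def)
          then show ?thesis by simp
        qed
      qed
      also have "\<dots> = (L x)\<^sup>2 * (\<Sum>y\<in>A. \<omega> x y * (d x y)\<^sup>2)"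
        by (simp add: sum_distrib_left)
      also have "\<dots> \<le> (L x)\<^sup>2 * \<mu> x"
        using intrinsic_finite_sum[OF intr, of x A] x A by (intro mult_left_mono) auto
      finally show "(\<Sum>y\<in>A. \<omega> x y * (\<phi> \<delta> x - \<phi> \<delta> y)\<^sup>2) \<le> (L x)\<^sup>2 * \<mu> x" .
    qed auto
    also have "\<dots> \<le> 1 / 2 * I"
      using bound[OF A(1,2)] by (simp add: v_def mult_ac)
    finally show ?thesis .
  qed
  \<comment> \<open>The bound does not depend on \<open>\<delta>\<close>, and for a fixed finite
    \<open>F\<close> the limit passes through the sum.\<close>
  have "((\<lambda>\<delta>. \<Sum>x\<in>F. q * V x * (\<phi> \<delta> x)\<^sup>2 * (v x)\<^sup>2 * \<mu> x)
      \<longlongrightarrow> (\<Sum>x\<in>F. q * V x * (max (\<psi> x - 0) 0)\<^sup>2 * (v x)\<^sup>2 * \<mu> x)) (at_right 0)"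
    unfolding \<phi>_def by (intro tendsto_intros)
  then have "(\<Sum>x\<in>F. q * V x * (max (\<psi> x - 0) 0)\<^sup>2 * (v x)\<^sup>2 * \<mu> x) \<le> 1 / 2 * I"
    by (rule tendsto_upperbound)
       (use trunc in \<open>auto simp: eventually_at_right_less intro: eventually_mono[OF eventually_at_right_less]\<close>)
  moreover have "(\<Sum>x\<in>F. q * V x * (max (\<psi> x - 0) 0)\<^sup>2 * (v x)\<^sup>2 * \<mu> x)
      = (\<Sum>x\<in>F. q * V x * (\<psi> x)\<^sup>2 * (v x)\<^sup>2 * \<mu> x)"
    using F \<psi>_pos by (intro sum.cong) (auto simp: max_def dest: order.antisym)
  ultimately show ?thesis by (simp add: v_def)
qed

end

section \<open>Choice of the weight and absorption\<close>

theorem theorem3p1: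
  fixes G :: "'a set"
    and \<mu> :: "'a \<Rightarrow> real"
    and \<omega> d :: "'a \<Rightarrow> 'a \<Rightarrow> real"
    and V u :: "'a \<Rightarrow> real"
    and x\<^sub>0 :: 'a
    and s c\<^sub>0 k \<alpha> \<beta> p :: real
  assumes "weighted_graph G \<mu> \<omega>"
    and "infinite_graph G"
    and "connected_graph G \<omega>"
    and "pseudo_metric G d"
    and "intrinsic G \<mu> \<omega> d"
    and "jump_size G \<omega> d = ereal s"
    and "\<And>x r. x \<in> G \<Longrightarrow> r > 0 \<Longrightarrow> finite (graph_ball G d x r)"
    and "x\<^sub>0 \<in> G"
    and "c\<^sub>0 > 0"
    and "k > s"
    and "0 < \<alpha>" and "\<alpha> \<le> 2"
    and "\<And>x. x \<in> G \<Longrightarrow> V x \<ge> 0"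
    and "\<And>x. x \<in> G \<Longrightarrow> V x \<ge> c\<^sub>0 * (d x x\<^sub>0 + k) powr (- \<alpha>)"
    and "schroedinger_solution G \<mu> \<omega> V u"
    and "\<beta> > 0"
    and "p \<ge> 2"
    and "u \<in> weighted_ell G \<mu> (\<lambda>x. (d x x\<^sub>0 + k) powr (- \<beta>)) p"
    and "p \<ge> \<beta>\<^sup>2 / (2 * c\<^sub>0) * (k powr (\<beta> + 1) / (k - s) powr (\<beta> + 1))\<^sup>2"
  shows "\<forall>x\<in>G. u x = 0"
proof -
  interpret weighted_graph G \<mu> \<omega> by fact
  \<comment> \<open>Enlarging \<open>k\<close> weakens the hypotheses on \<open>V\<close> and \<open>u\<close>; once \<open>r \<ge> 1\<close>, the case \<open>\<alpha> = 2\<close> is the worst.\<close>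
  define K where "K = max k 1"
  define r where "r x = d x x\<^sub>0 + K" for x
  \<comment> \<open>\<open>T\<close> is the constant of \<open>powr_shift_bound\<close> for exponent
    \<open>\<beta> + 2\<close>. It keeps the original \<open>k\<close>, to be comparable with the
    bound on \<open>p\<close>. In \<open>C\<close>, the other factor is the square of
    \<open>\<beta> / 2\<close>, from differentiating the weight.\<close>
  define T where "T = (k / (k - s)) powr (\<beta> + 2)"
  define q where "q = p / 2"
  define g where "g x = r x powr (- \<beta> - 2) * (\<bar>u x\<bar> powr q)\<^sup>2 * \<mu> x" for x
  define C where "C = \<beta>\<^sup>2 / 4 * T"
  have s: "s \<ge> 0" using assms(4,6) by (rule jump_size_nonneg)
  have k: "k > 0" "K \<ge> 1" "K \<ge> k" "K > s" using s assms(10) by (auto simp: K_def)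
  have d_nonneg: "d x y \<ge> 0" if "x \<in> G" "y \<in> G" for x y
    using that assms(4) by (auto simp: pseudo_metric_def)
  have d_sym: "d x y = d y x" if "x \<in> G" "y \<in> G" for x y
    using that assms(4) by (auto simp: pseudo_metric_def)
  have d_tri: "d x y \<le> d x z + d y z" if "x \<in> G" "y \<in> G" "z \<in> G" for x y z
    using that assms(4) by (auto simp: pseudo_metric_def)
  have r: "r x \<ge> K" if "x \<in> G" for x
    using d_nonneg[OF that assms(8)] by (simp add: r_def)
  have r_diff: "\<bar>r x - r y\<bar> \<le> d x y" if "x \<in> G" "y \<in> G" for x y
    using d_tri[of x x\<^sub>0 y] d_tri[of y x\<^sub>0 x] d_sym[of x y] d_sym[of y x\<^sub>0] d_sym[of x x\<^sub>0] that assms(8)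
    by (auto simp: r_def)

  have loc_fin: "finite {y \<in> G. adjacent \<omega> x y}" if "x \<in> G" for x
  proof (rule finite_subset)
    \<comment> \<open>Balls are open and need a positive radius, hence \<open>s + 1\<close> instead
      of \<open>s\<close>.\<close>
    show "{y \<in> G. adjacent \<omega> x y} \<subseteq> graph_ball G d x (s + 1)"
      using dist_le_jump_size[OF assms(6) that] d_sym[OF that] by (force simp: graph_ball_def)
    show "finite (graph_ball G d x (s + 1))"
      using assms(7) that s by simp
  qed

  have superlevel: "finite {x \<in> G. r x powr (- \<beta> / 2) > \<delta>}" if "\<delta> > 0" for \<delta>
  proof (rule finite_subset)
    \<comment> \<open>\<open>R\<close> solves
      \<open>R powr (- \<beta> / 2) = \<delta>\<close>.\<close>
    define R where "R = \<delta> powr (- 2 / \<beta>)"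
    have "r x < R" if x: "x \<in> G" "r x powr (- \<beta> / 2) > \<delta>" for x
    proof (rule ccontr)
      assume "\<not> r x < R"
      moreover have "R > 0" using \<open>\<delta> > 0\<close> by (simp add: R_def)
      ultimately have "r x powr (- \<beta> / 2) \<le> R powr (- \<beta> / 2)"
        using assms(16) by (intro powr_mono2') auto
      also have "\<dots> = \<delta>"
        using assms(16) \<open>\<delta> > 0\<close> by (simp add: R_def powr_powr)
      finally show False using x by simp
    qed
    then show "{x \<in> G. r x powr (- \<beta> / 2) > \<delta>} \<subseteq> graph_ball G d x\<^sub>0 R"
      using k by (force simp: graph_ball_def r_def)
    show "finite (graph_ball G d x\<^sub>0 R)"
      using assms(7,8) \<open>\<delta> > 0\<close> by (simp add: R_def)
  qed

  have lip: "\<bar>r x powr (- \<beta> / 2) - r y powr (- \<beta> / 2)\<bar> \<le> \<beta> / 2 * (r x - s) powr (- \<beta> / 2 - 1) * d x y"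
    if "x \<in> G" "y \<in> G" "adjacent \<omega> x y" for x y
  proof -
    have dxy: "d x y \<le> s" using dist_le_jump_size[OF assms(6)] that by blast
    \<comment> \<open>Along an edge \<open>r\<close> changes by at most \<open>s\<close>, so
      \<open>r x - s\<close> is a positive lower bound for both \<open>r x\<close> and
      \<open>r y\<close> that depends on \<open>x\<close> alone.\<close>
    have "\<bar>r x powr (- (\<beta> / 2)) - r y powr (- (\<beta> / 2))\<bar>
        \<le> \<beta> / 2 * (r x - s) powr (- (\<beta> / 2) - 1) * \<bar>r x - r y\<bar>"
      using assms(16) s k r[of x] r_diff[of x y] dxy that
      by (intro powr_minus_lipschitz) auto
    also have "\<dots> \<le> \<beta> / 2 * (r x - s) powr (- (\<beta> / 2) - 1) * d x y"
      using assms(16) r_diff that by (intro mult_left_mono) auto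
    finally show ?thesis by simp
  qed

  have L_sq: "(\<beta> / 2 * (r x - s) powr (- \<beta> / 2 - 1))\<^sup>2 \<le> C * r x powr (- \<beta> - 2)" if "x \<in> G" for x
  proof -
    have "((r x - s) powr (- \<beta> / 2 - 1))\<^sup>2 = (r x - s) powr (- (\<beta> + 2))"
      by (simp add: power2_eq_square flip: powr_add)
    also have "\<dots> \<le> T * r x powr (- (\<beta> + 2))"
      unfolding T_def using s assms(10,16) r[OF that] k by (intro powr_shift_bound) auto
    finally have "\<beta>\<^sup>2 / 4 * ((r x - s) powr (- \<beta> / 2 - 1))\<^sup>2 \<le> \<beta>\<^sup>2 / 4 * (T * r x powr (- (\<beta> + 2)))"
      by (rule mult_left_mono) simp
    then show ?thesis
      by (simp add: C_def power_mult_distrib power_divide mult_ac)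
  qed

  have v_sq: "(\<bar>u x\<bar> powr q)\<^sup>2 = \<bar>u x\<bar> powr p" for x
    by (simp add: q_def power2_eq_square flip: powr_add)
  have g_nonneg: "g x \<ge> 0" if "x \<in> G" for x
    using measure_pos[OF that] by (simp add: g_def)
  have g_summable: "g summable_on G"
  proof (rule summable_on_comparison_test)
    show "(\<lambda>x. \<bar>u x\<bar> powr p * (d x x\<^sub>0 + k) powr (- \<beta>) * \<mu> x) summable_on G"
      using assms(18) by (simp add: weighted_ell_def)
    fix x assume x: "x \<in> G"
    \<comment> \<open>\<open>K \<ge> 1\<close> permits the larger exponent, and
      \<open>K \<ge> k\<close> the return to the weight in the hypothesis on
      \<open>u\<close>.\<close>
    have "r x powr (- \<beta> - 2) \<le> r x powr (- \<beta>)"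
      using r[OF x] k by (intro powr_mono) auto
    also have "\<dots> \<le> (d x x\<^sub>0 + k) powr (- \<beta>)"
      using d_nonneg[OF x assms(8)] k assms(16) by (intro powr_mono2') (auto simp: r_def)
    finally have "r x powr (- \<beta> - 2) * (\<bar>u x\<bar> powr p * \<mu> x)
        \<le> (d x x\<^sub>0 + k) powr (- \<beta>) * (\<bar>u x\<bar> powr p * \<mu> x)"
      using measure_pos[OF x] by (intro mult_right_mono) auto
    then show "g x \<le> \<bar>u x\<bar> powr p * (d x x\<^sub>0 + k) powr (- \<beta>) * \<mu> x"
      by (simp add: g_def v_sq mult_ac)
  qed (rule g_nonneg)
  define I where "I = infsum g G"
  have sum_g: "sum g A \<le> I" if "finite A" "A \<subseteq> G" for A
    unfolding I_def using that g_nonneg by (intro finite_sum_le_infsum g_summable) auto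

  have V_low: "c\<^sub>0 * r x powr (- 2) \<le> V x" if "x \<in> G" for x
  proof -
    have "r x powr (- 2) \<le> r x powr (- \<alpha>)"
      using r[OF that] k assms(12) by (intro powr_mono) auto
    also have "\<dots> \<le> (d x x\<^sub>0 + k) powr (- \<alpha>)"
      using d_nonneg[OF that assms(8)] k assms(11) by (intro powr_mono2') (auto simp: r_def)
    finally have "c\<^sub>0 * r x powr (- 2) \<le> c\<^sub>0 * (d x x\<^sub>0 + k) powr (- \<alpha>)"
      using assms(9) by (intro mult_left_mono) auto
    with assms(14)[OF that] show ?thesis by linarith
  qed

  have "q * c\<^sub>0 * sum g F \<le> 1 / 2 * (C * I)" if F: "finite F" "F \<subseteq> G" for F
  proof -
    have "q * c\<^sub>0 * sum g F \<le> (\<Sum>x\<in>F. q * V x * (r x powr (- \<beta> / 2))\<^sup>2 * (\<bar>u x\<bar> powr q)\<^sup>2 * \<mu> x)"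
      unfolding sum_distrib_left
    proof (rule sum_mono)
      fix x assume "x \<in> F"
      then have x: "x \<in> G" using F by auto
      \<comment> \<open>The decay of the lower bound on \<open>V\<close> and that of the squared
        weight combine to exactly the decay in \<open>g\<close>.\<close>
      have "r x powr (- 2) * (r x powr (- \<beta> / 2))\<^sup>2 = r x powr (- \<beta> - 2)"
        by (simp add: power2_eq_square algebra_simps flip: powr_add)
      then have "q * c\<^sub>0 * g x = (c\<^sub>0 * r x powr (- 2)) * (q * (r x powr (- \<beta> / 2))\<^sup>2 * (\<bar>u x\<bar> powr q)\<^sup>2 * \<mu> x)"
        by (simp only: g_def mult_ac) (simp add: mult_ac)
      also have "\<dots> \<le> V x * (q * (r x powr (- \<beta> / 2))\<^sup>2 * (\<bar>u x\<bar> powr q)\<^sup>2 * \<mu> x)"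
        using V_low[OF x] measure_pos[OF x] assms(17) by (intro mult_right_mono) (auto simp: q_def)
      finally show "q * c\<^sub>0 * g x \<le> q * V x * (r x powr (- \<beta> / 2))\<^sup>2 * (\<bar>u x\<bar> powr q)\<^sup>2 * \<mu> x"
        by (simp add: mult_ac)
    qed
    also have "\<dots> \<le> 1 / 2 * (C * I)"
    proof (rule weighted_energy_bound[OF assms(5) loc_fin superlevel _ lip assms(15,13) _ _ F])
      fix A assume A: "finite A" "A \<subseteq> G"
      have "(\<Sum>x\<in>A. (\<beta> / 2 * (r x - s) powr (- \<beta> / 2 - 1))\<^sup>2 * (\<bar>u x\<bar> powr q)\<^sup>2 * \<mu> x) \<le> (\<Sum>x\<in>A. C * g x)"
      proof (rule sum_mono)
        fix x assume "x \<in> A"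
        then have x: "x \<in> G" using A by auto
        have "(\<beta> / 2 * (r x - s) powr (- \<beta> / 2 - 1))\<^sup>2 * ((\<bar>u x\<bar> powr q)\<^sup>2 * \<mu> x)
            \<le> C * r x powr (- \<beta> - 2) * ((\<bar>u x\<bar> powr q)\<^sup>2 * \<mu> x)"
          using L_sq[OF x] measure_pos[OF x] by (intro mult_right_mono) auto
        then show "(\<beta> / 2 * (r x - s) powr (- \<beta> / 2 - 1))\<^sup>2 * (\<bar>u x\<bar> powr q)\<^sup>2 * \<mu> x \<le> C * g x"
          by (simp add: g_def mult_ac)
      qed
      also have "\<dots> = C * sum g A" by (simp add: sum_distrib_left)
      also have "\<dots> \<le> C * I"
        using sum_g[OF A] by (intro mult_left_mono) (auto simp: C_def T_def)
      finally show "(\<Sum>x\<in>A. (\<beta> / 2 * (r x - s) powr (- \<beta> / 2 - 1))\<^sup>2 * (\<bar>u x\<bar> powr q)\<^sup>2 * \<mu> x) \<le> C * I" .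
    qed (use assms(17) in \<open>auto simp: q_def\<close>)
    finally show ?thesis .
  qed
  then have "sum g F \<le> C * I / (2 * q * c\<^sub>0)" if "finite F" "F \<subseteq> G" for F
    using that assms(9,17) by (simp add: field_simps q_def)
  \<comment> \<open>Exhausting \<open>G\<close> by finite sets puts the same real number
    \<open>I\<close> on both sides, so it can be absorbed once
    \<open>C < p * c\<^sub>0\<close>.\<close>
  then have "I \<le> C * I / (2 * q * c\<^sub>0)"
    unfolding I_def by (intro infsum_le_finite_sums g_summable) (simp_all flip: I_def)
  then have key: "p * c\<^sub>0 * I \<le> C * I"
    using assms(9,17) by (simp add: field_simps q_def)

  \<comment> \<open>The hypothesis on \<open>p\<close> has a factor \<open>2\<close> to spare, which makes the absorption strict.\<close>
  have "C < p * c\<^sub>0"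
  proof -
    \<comment> \<open>The base is at least 1, so the exponent \<open>\<beta> + 2\<close> of
      \<open>T\<close> may be raised to the \<open>2 * (\<beta> + 1)\<close> that occurs in the
      bound on \<open>p\<close>.\<close>
    have "k / (k - s) \<ge> 1" using s assms(10) by simp
    then have "T \<le> (k / (k - s)) powr ((\<beta> + 1) + (\<beta> + 1))"
      unfolding T_def using assms(16) by (intro powr_mono) auto
    also have "\<dots> = ((k / (k - s)) powr (\<beta> + 1))\<^sup>2"
      by (simp only: powr_add power2_eq_square)
    also have "\<dots> = (k powr (\<beta> + 1) / (k - s) powr (\<beta> + 1))\<^sup>2"
      using k assms(10) by (simp add: powr_divide)
    finally have "\<beta>\<^sup>2 / 2 * T \<le> \<beta>\<^sup>2 / 2 * (k powr (\<beta> + 1) / (k - s) powr (\<beta> + 1))\<^sup>2"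
      by (rule mult_left_mono) simp
    also have "\<dots> \<le> p * c\<^sub>0"
      using mult_right_mono[OF assms(19), of "c\<^sub>0"] assms(9) by simp
    finally have "2 * C \<le> p * c\<^sub>0" by (simp add: C_def mult.commute)
    moreover have "C > 0" using k assms(10,16) by (simp add: C_def T_def)
    ultimately show ?thesis by linarith
  qed
  with key have "I \<le> 0"
    by (meson mult_le_cancel_right not_le)
  show ?thesis
  proof
    fix x assume x: "x \<in> G"
    have "g x = 0" using sum_g[of "{x}"] g_nonneg[OF x] x \<open>I \<le> 0\<close> by simp
    moreover have "r x > 0" using r[OF x] k by simp
    ultimately show "u x = 0"
      using measure_pos[OF x] by (auto simp: g_def)
  qed
qed

end
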